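(* Let $h_{n,m}$ denote the complete symmetric polynomial of degree $m$ in the variables $X_1,\dots,X_n$ (with rational coefficients). For all integers $n\ge 1$ and $d\ge 0$ the following identities hold: \[ h_{n,2d+1}=\frac{1}{2^{2d}(2d+1)!}\sum_{k=0}^d(-1)^{d-k}\binom{n+2d}{d-k}\sum_{1\le i_1\le i_2\le\cdots\le i_k\le n}\Bigl(h_{n,1}+2\sum_{j=1}^kX_{i_j}\Bigr)^{2d+1} \] and \[ h_{n,2d}=\frac{1}{2^{2d}(2d)!}\sum_{k=0}^d(-1)^{d-k}\left[\binom{n+2d-1}{d-k}-\binom{n+2d-1}{d-k-1}\right]\sum_{1\le i_1\le i_2\le\cdots\le i_k\le n}\Bigl(h_{n,1}+2\sum_{j=1}^kX_{i_j}\Bigr)^{2d}, \] where in both cases, for $k=0$, the inner summation consists of the single term $h_{n,1}^{2d+1}$, respectively $h_{n,1}^{2d}$.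
   Context: $h_{n,m}=\sum_{i_1+\cdots+i_n=m}X_1^{i_1}\cdots X_n^{i_n}$ (sum over nonnegative exponents); in particular $h_{n,0}=1$ and $h_{n,1}=X_1+\cdots+X_n$. Convention: $\binom{a}{-1}=0$, and a zeroth power equals $1$. *)

theory Defs
  imports Complex_Main "HOL-Library.Poly_Mapping" "HOL-Library.FuncSet"
begin

text \<open>
  Polynomials with rational coefficients in the variables \<open>X\<^sub>0, X\<^sub>1, X\<^sub>2, \<dots>\<close>: finitely supported
  maps from exponent vectors to coefficients, with the convolution product of
  \<^theory>\<open>HOL-Library.Poly_Mapping\<close>.
\<close>

type_synonym rat_mpoly = "(nat \<Rightarrow>\<^sub>0 nat) \<Rightarrow>\<^sub>0 rat"

definition X :: "nat \<Rightarrow> rat_mpoly" where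
  "X i = Poly_Mapping.single (Poly_Mapping.single i 1) 1"

definition Const :: "rat \<Rightarrow> rat_mpoly" where
  "Const c = Poly_Mapping.single 0 c"

text \<open>
  Exponent tuples \<open>(i\<^sub>1, \<dots>, i\<^sub>n)\<close> are extensional functions on \<open>{1..n}\<close>, so that each tuple
  is counted exactly once.
\<close>

definition exponents :: "nat \<Rightarrow> nat \<Rightarrow> (nat \<Rightarrow> nat) set" where
  "exponents n m = {e \<in> {1..n} \<rightarrow>\<^sub>E UNIV. (\<Sum>j=1..n. e j) = m}"

definition h :: "nat \<Rightarrow> nat \<Rightarrow> rat_mpoly" where
  "h n m = (\<Sum>e\<in>exponents n m. \<Prod>j=1..n. X j ^ e j)"

text \<open>
  The sequences \<open>1 \<le> i\<^sub>1 \<le> \<dots> \<le> i\<^sub>k \<le> n\<close> as lists, hence indexed from \<open>0\<close>: \<open>i\<^sub>j\<close> is \<open>is ! (j - 1)\<close>.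
\<close>

definition weak_seqs :: "nat \<Rightarrow> nat \<Rightarrow> nat list set" where
  "weak_seqs n k = {is. length is = k \<and> sorted is \<and> set is \<subseteq> {1..n}}"

text \<open>The binomial coefficient with integer lower index, which vanishes for negative lower index.\<close>

definition binom :: "nat \<Rightarrow> int \<Rightarrow> nat" where
  "binom a b = (if b < 0 then 0 else a choose nat b)"

end

theory Submission
  imports Defs "HOL-Computational_Algebra.Formal_Power_Series"
begin

text \<open>
  Let \<open>W\<^sub>m(q) = \<Sum>\<^sub>k q\<^sup>k \<Sum> (h\<^sub>1 + 2 \<Sum>\<^sub>j X\<^bsub>i\<^sub>j\<^esub>)\<^sup>m\<close>, the inner sum over the weakly increasing
  sequences of length \<open>k\<close>. Its exponential generating function in \<open>m\<close> is the product over the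
  variables of \<open>\<Sum>\<^sub>k q\<^sup>k exp ((2k + 1) X\<^sub>j t)\<close>, so \<open>(1 - q)\<^bsup>n+m\<^esup> W\<^sub>m(q)\<close> is a combination of products of
  type B Eulerian polynomials. It is therefore a polynomial \<open>P\<^sub>m(q)\<close>, palindromic of degree \<open>m\<close>,
  with \<open>P\<^sub>m(1) = 2\<^sup>m m! h\<^sub>m\<close>. The sum over \<open>k\<close> in the theorem is the coefficient of \<open>q\<^sup>d\<close> in
  \<open>P\<^sub>m(q) / (1 - q)\<close> for \<open>m = 2d + 1\<close> and in \<open>(1 + q) P\<^sub>m(q) / (1 - q)\<close> for \<open>m = 2d\<close>; by symmetry these
  are \<open>P\<^sub>m(1) / 2\<close> and \<open>P\<^sub>m(1)\<close>.
\<close>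

section \<open>Palindromic polynomials, represented as power series\<close>

unbundle fps_syntax

text \<open>The third argument is the value of the polynomial at 1. The degree bound \<open>m\<close> need not be attained.\<close>

definition palindromic :: "'a::comm_ring_1 fps \<Rightarrow> nat \<Rightarrow> 'a \<Rightarrow> bool" where
  "palindromic p m s \<longleftrightarrow>
     (\<forall>i>m. p $ i = 0) \<and> (\<forall>i\<le>m. p $ i = p $ (m - i)) \<and> (\<Sum>i\<le>m. p $ i) = s"

lemma palindromic_fps_const: "palindromic (fps_const c) 0 c"
  by (simp add: palindromic_def)

lemma palindromic_0: "palindromic 0 m 0"
  by (simp add: palindromic_def)

text \<open>The reflection (i, j) to (m - i, l - j) carries the terms of coefficient r to those of
  coefficient m + l - r.\<close>

lemma palindromic_mult:
  assumes p: "palindromic p m s" and q: "palindromic q l t"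
  shows "palindromic (p * q) (m + l) (s * t)"
proof -
  have p0: "p $ i = 0" if "i > m" for i using p that by (simp add: palindromic_def)
  have q0: "q $ i = 0" if "i > l" for i using q that by (simp add: palindromic_def)
  have psym: "p $ (m - i) = p $ i" if "i \<le> m" for i
    using p that unfolding palindromic_def by metis
  have qsym: "q $ (l - i) = q $ i" if "i \<le> l" for i
    using q that unfolding palindromic_def by metis
  \<comment> \<open>Index pairs are confined to the box i \<le> m, j \<le> l, where truncated
    subtraction is an involution; all terms outside vanish.\<close>
  define D where "D r = {(i, j). i \<le> m \<and> j \<le> l \<and> i + j = r}" for r
  have finD: "finite (D r)" for r
    by (rule finite_subset[of _ "{..m} \<times> {..l}"]) (auto simp: D_def)
  have nth: "(p * q) $ r = (\<Sum>(i, j)\<in>D r. p $ i * q $ j)" for r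
  proof -
    have "(p * q) $ r = (\<Sum>i\<in>{0..r}. p $ i * q $ (r - i))"
      by (simp add: fps_mult_nth)
    also have "\<dots> = (\<Sum>(i, j)\<in>(\<lambda>i. (i, r - i)) ` {0..r}. p $ i * q $ j)"
      by (subst sum.reindex) (auto simp: inj_on_def)
    also have "\<dots> = (\<Sum>(i, j)\<in>D r. p $ i * q $ j)"
    proof (rule sum.mono_neutral_right)
      show "D r \<subseteq> (\<lambda>i. (i, r - i)) ` {0..r}"
        by (auto simp: D_def image_iff)
      show "\<forall>x\<in>(\<lambda>i. (i, r - i)) ` {0..r} - D r. (case x of (i, j) \<Rightarrow> p $ i * q $ j) = 0"
      proof safe
        fix i assume "i \<in> {0..r}" "(i, r - i) \<notin> D r"
        then have "i > m \<or> r - i > l" by (auto simp: D_def)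
        then show "p $ i * q $ (r - i) = 0" by (auto simp: p0 q0)
      qed
    qed simp
    finally show ?thesis .
  qed
  have "(p * q) $ r = 0" if "r > m + l" for r
  proof -
    have "D r = {}" using that by (auto simp: D_def)
    then show ?thesis by (simp add: nth)
  qed
  moreover have "(p * q) $ r = (p * q) $ (m + l - r)" if "r \<le> m + l" for r
    unfolding nth
    by (rule sum.reindex_bij_witness[where i = "\<lambda>(i, j). (m - i, l - j)" and j = "\<lambda>(i, j). (m - i, l - j)"])
       (use that in \<open>auto simp: D_def psym qsym\<close>)
  moreover have "(\<Sum>r\<le>m + l. (p * q) $ r) = s * t"
  proof -
    have "(\<Sum>r\<le>m + l. (p * q) $ r) = (\<Sum>(r, i, j)\<in>Sigma {..m + l} D. p $ i * q $ j)"
      unfolding nth by (subst sum.Sigma) (auto simp: finD split_def)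
    also have "\<dots> = (\<Sum>(i, j)\<in>{..m} \<times> {..l}. p $ i * q $ j)"
      by (rule sum.reindex_bij_witness[where i = "\<lambda>(i, j). (i + j, i, j)" and j = snd])
         (auto simp: D_def)
    also have "\<dots> = (\<Sum>i\<le>m. p $ i) * (\<Sum>j\<le>l. q $ j)"
      by (simp add: sum_product sum.cartesian_product)
    also have "\<dots> = s * t"
      using p q unfolding palindromic_def by metis
    finally show ?thesis .
  qed
  ultimately show ?thesis unfolding palindromic_def by blast
qed

lemma palindromic_sum:
  assumes "\<And>i. i \<in> I \<Longrightarrow> palindromic (f i) m (s i)"
  shows "palindromic (\<Sum>i\<in>I. f i) m (\<Sum>i\<in>I. s i)"
proof -
  have zero: "f i $ r = 0" if "i \<in> I" "r > m" for i r
    using assms[OF that(1)] that(2) unfolding palindromic_def by blast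
  have sym: "f i $ r = f i $ (m - r)" if "i \<in> I" "r \<le> m" for i r
    using assms[OF that(1)] that(2) unfolding palindromic_def by blast
  have total: "(\<Sum>r\<le>m. f i $ r) = s i" if "i \<in> I" for i
    using assms[OF that] unfolding palindromic_def by blast
  have "(\<Sum>r\<le>m. \<Sum>i\<in>I. f i $ r) = (\<Sum>i\<in>I. s i)"
    by (subst sum.swap) (simp add: total)
  moreover have "(\<Sum>i\<in>I. f i $ r) = (\<Sum>i\<in>I. f i $ (m - r))" if "r \<le> m" for r
    using that by (intro sum.cong refl sym)
  moreover have "(\<Sum>i\<in>I. f i $ r) = 0" if "r > m" for r
    using that by (simp add: zero)
  ultimately show ?thesis
    unfolding palindromic_def fps_sum_nth by blast
qed

section \<open>Eulerian polynomials of type B\<close>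

definition odd_power_gf :: "nat \<Rightarrow> 'a::comm_ring_1 fps" where
  "odd_power_gf a = Abs_fps (\<lambda>k. (2 * of_nat k + 1) ^ a)"

text \<open>The polynomials \<open>(1 - q)\<^bsup>a+1\<^esup> \<Sum>\<^sub>k (2k + 1)\<^sup>a q\<^sup>k\<close> are the Eulerian polynomials of type B.\<close>

lemma palindromic_odd_power_gf:
  "palindromic ((1 - fps_X) ^ Suc a * odd_power_gf a :: 'a::comm_ring_1 fps) a (of_nat (2 ^ a * fact a))"
proof (induction a)
  case 0
  have "(1 - fps_X) * odd_power_gf 0 = (1 :: 'a fps)"
    by (rule fps_ext) (auto simp: odd_power_gf_def left_diff_distrib)
  then show ?case
    using palindromic_fps_const[of "1 :: 'a"] by simp
next
  case (Suc a)
  define A :: "'a fps" where "A = odd_power_gf a"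
  define B where "B = (1 - fps_X) ^ Suc a * A"
  define C :: "'a fps" where "C = (1 - fps_X) ^ Suc (Suc a) * odd_power_gf (Suc a)"
  have IH: "palindromic B a (of_nat (2 ^ a * fact a))" using Suc by (simp add: A_def B_def)
  \<comment> \<open>The factor 2k + 1 on the k-th coefficient is the operator 1 + 2 q d/dq.\<close>
  have A_Suc: "odd_power_gf (Suc a) = A + 2 * fps_X * fps_deriv A"
  proof (rule fps_ext)
    fix k
    have "(2 * fps_X * fps_deriv A) $ k = 2 * (of_nat k * A $ k)"
      by (cases k) (simp_all add: mult.assoc fps_numeral_fps_const)
    then show "odd_power_gf (Suc a) $ k = (A + 2 * fps_X * fps_deriv A) $ k"
      by (simp add: A_def odd_power_gf_def algebra_simps)
  qed
  have dB: "fps_deriv B = (1 - fps_X) ^ Suc a * fps_deriv A - of_nat (Suc a) * (1 - fps_X) ^ a * A"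
  proof -
    have "fps_deriv ((1 - fps_X :: 'a fps) ^ Suc a) = - (of_nat (Suc a) * (1 - fps_X) ^ a)"
      by (subst fps_deriv_power) (simp add: fps_of_nat del: of_nat_Suc)
    then show ?thesis
      unfolding B_def by (simp only: fps_deriv_mult) (simp add: mult_ac del: of_nat_Suc power_Suc)
  qed
  \<comment> \<open>By \<open>dB\<close>, (1 - q)^(a+2) A' equals (1 - q) B' + (a + 1) B, which
    eliminates A.\<close>
  have C_eq: "C = (1 - fps_X) * B + 2 * fps_X * ((1 - fps_X) * fps_deriv B + of_nat (Suc a) * B)"
    unfolding C_def A_Suc dB by (simp add: B_def algebra_simps)
  have C0: "C $ 0 = B $ 0"
    by (simp add: C_eq)
  have C_Suc: "C $ Suc i = (2 * of_nat i + 3) * B $ Suc i + (2 * of_nat a + 1 - 2 * of_nat i) * B $ i" for i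
  proof -
    have *: "(fps_X * fps_deriv B) $ i = of_nat i * B $ i"
      by (cases i) simp_all
    define D where "D = fps_deriv B - fps_X * fps_deriv B + fps_const (of_nat (Suc a)) * B"
    have "C = B - fps_X * B + fps_const 2 * (fps_X * D)"
      unfolding C_eq D_def fps_of_nat[symmetric] fps_numeral_fps_const[symmetric]
      by (simp only: algebra_simps mult_1_right mult_1_left)
    then have "C $ Suc i = B $ Suc i - B $ i + 2 * D $ i"
      by simp
    also have "D $ i = of_nat (Suc i) * B $ Suc i - of_nat i * B $ i + of_nat (Suc a) * B $ i"
      by (simp only: D_def fps_add_nth fps_sub_nth * fps_deriv_nth fps_mult_left_const_nth Suc_eq_plus1)
    finally show ?thesis
      by (simp add: algebra_simps)
  qed
  have B0: "B $ i = 0" if "i > a" for i using IH that by (simp add: palindromic_def)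
  have Bsym: "B $ (a - i) = B $ i" if "i \<le> a" for i
    using IH that unfolding palindromic_def by metis
  have "C $ i = 0" if "i > Suc a" for i
    using that by (cases i) (auto simp: C_Suc B0)
  moreover have "C $ i = C $ (Suc a - i)" if i: "i \<le> Suc a" for i
  proof -
    consider "i = 0" | "i = Suc a" | j where "i = Suc j" "j < a"
      using i by (cases i) force+
    then show ?thesis
    proof cases
      case 1
      then show ?thesis using Bsym[of 0] by (simp add: C0 C_Suc B0)
    next
      case 2
      then show ?thesis using Bsym[of 0] by (simp add: C0 C_Suc B0)
    next
      case 3
      \<comment> \<open>The reflected index is \<open>Suc l\<close>; since 2l + 3 = 2a + 1 - 2j, the
        reflection exchanges the two terms of \<open>C_Suc\<close>.\<close>
      then obtain l where l: "a = Suc (j + l)"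
        using less_imp_Suc_add by blast
      show ?thesis
        using Bsym[of j] Bsym[of "Suc j"] 3 by (simp add: l C_Suc algebra_simps Suc_diff_le)
    qed
  qed
  moreover have "(\<Sum>i\<le>Suc a. C $ i) = of_nat (2 ^ Suc a * fact (Suc a))"
  proof -
    have "(\<Sum>i\<le>Suc a. C $ i) = B $ 0 + (\<Sum>i\<le>a. (2 * of_nat i + 3) * B $ Suc i)
             + (\<Sum>i\<le>a. (2 * of_nat a + 1 - 2 * of_nat i) * B $ i)"
      by (simp only: sum.atMost_Suc_shift C0 C_Suc sum.distrib add.assoc)
    also have "B $ 0 + (\<Sum>i\<le>a. (2 * of_nat i + 3) * B $ Suc i)
        = (\<Sum>i\<le>Suc a. (2 * of_nat i + 1) * B $ i)"
      by (subst sum.atMost_Suc_shift) (simp add: algebra_simps)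
    also have "\<dots> = (\<Sum>i\<le>a. (2 * of_nat i + 1) * B $ i)"
      by (simp add: B0)
    \<comment> \<open>The two weights of \<open>B $ i\<close> add up to 2(a + 1) for every i, so the
      value at 1 is multiplied by this constant.\<close>
    also have "\<dots> + (\<Sum>i\<le>a. (2 * of_nat a + 1 - 2 * of_nat i) * B $ i)
        = (\<Sum>i\<le>a. 2 * of_nat (Suc a) * B $ i)"
      by (simp add: sum.distrib[symmetric] algebra_simps)
    also have "\<dots> = 2 * of_nat (Suc a) * of_nat (2 ^ a * fact a)"
      using IH unfolding palindromic_def sum_distrib_left[symmetric] by metis
    also have "\<dots> = of_nat (2 ^ Suc a * fact (Suc a))"
      by (simp add: algebra_simps)
    finally show ?thesis .
  qed
  ultimately show ?case
    unfolding palindromic_def C_def[symmetric] by blast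
qed

section \<open>Complete symmetric polynomials, one variable at a time\<close>

lemma finite_exponents: "finite (exponents n m)"
proof (rule finite_subset)
  show "exponents n m \<subseteq> {1..n} \<rightarrow>\<^sub>E {..m}"
    by (auto simp: exponents_def PiE_iff extensional_def intro!: member_le_sum)
qed (simp add: finite_PiE)

lemma exponents_0: "exponents 0 m = (if m = 0 then {\<lambda>_. undefined} else {})"
  by (auto simp: exponents_def PiE_iff extensional_def fun_eq_iff)

lemma h_0: "h 0 m = (if m = 0 then 1 else 0)"
  by (simp add: h_def exponents_0)

text \<open>Monomials are grouped by the exponent m - i of the last variable.\<close>

lemma h_Suc: "h (Suc n) m = (\<Sum>i\<le>m. h n i * X (Suc n) ^ (m - i))"
proof -
  have "(\<Sum>i\<le>m. h n i * X (Suc n) ^ (m - i)) =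
      (\<Sum>(i, e)\<in>Sigma {..m} (exponents n). (\<Prod>j=1..n. X j ^ e j) * X (Suc n) ^ (m - i))"
    by (simp add: h_def sum_distrib_right sum.Sigma finite_exponents)
  \<comment> \<open>Removing the last exponent resets it to \<open>undefined\<close>, since the
    tuples in \<open>exponents n\<close> are extensional on {1..n}.\<close>
  also have "\<dots> = (\<Sum>e\<in>exponents (Suc n) m. (\<Prod>j=1..n. X j ^ e j) * X (Suc n) ^ e (Suc n))"
    by (rule sum.reindex_bij_witness[where
          j = "\<lambda>(i, e). e(Suc n := m - i)" and
          i = "\<lambda>e. (m - e (Suc n), e(Suc n := undefined))"])
       (auto simp: exponents_def PiE_iff extensional_def fun_eq_iff)
  also have "\<dots> = h (Suc n) m"
    by (simp add: h_def)
  finally show ?thesis by simp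
qed

lemma h_degree_0: "h n 0 = 1"
  by (induction n) (simp_all add: h_0 h_Suc)

lemma h_Suc_1: "h (Suc n) 1 = h n 1 + X (Suc n)"
  by (simp add: h_Suc h_degree_0)

section \<open>Weakly increasing sequences and their generating function\<close>

lemma finite_weak_seqs: "finite (weak_seqs n k)"
  by (rule finite_subset[OF _ finite_lists_length_eq[of "{1..n}" k]]) (auto simp: weak_seqs_def)

text \<open>Sortedness puts all copies of n + 1 at the end; j counts the entries before
  them.\<close>

lemma sum_weak_seqs_Suc:
  "(\<Sum>is\<in>weak_seqs (Suc n) k. f is) =
   (\<Sum>j\<le>k. \<Sum>is\<in>weak_seqs n j. f (is @ replicate (k - j) (Suc n)))"
proof -
  \<comment> \<open>Deleting the copies of n + 1 and appending equally many restores the list, as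
    nothing smaller can follow such a copy.\<close>
  have split: "is = filter (\<lambda>i. i \<noteq> Suc n) is @ replicate (k - length (filter (\<lambda>i. i \<noteq> Suc n) is)) (Suc n)"
    if "sorted is" "set is \<subseteq> {1..Suc n}" "length is = k" for "is" k
    using that
  proof (induction "is" arbitrary: k)
    case (Cons a as)
    show ?case
    proof (cases "a = Suc n")
      case True
      then have "set as \<subseteq> {Suc n}" using Cons.prems by force
      then have "as = replicate (length as) (Suc n)"
        by (intro replicate_eqI) auto
      then have "a # as = replicate (Suc (length as)) (Suc n)"
        by (simp add: True)
      moreover have "filter (\<lambda>i. i \<noteq> Suc n) (a # as) = []"
        using \<open>set as \<subseteq> {Suc n}\<close> True by (auto simp: filter_empty_conv)
      ultimately show ?thesis
        using Cons.prems(3) by (metis append_Nil diff_zero length_replicate list.size(3))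
    next
      case False
      then show ?thesis using Cons.prems Cons.IH[of "length as"] by auto
    qed
  qed simp
  have "(\<Sum>j\<le>k. \<Sum>is\<in>weak_seqs n j. f (is @ replicate (k - j) (Suc n))) =
      (\<Sum>(j, is)\<in>Sigma {..k} (weak_seqs n). f (is @ replicate (k - j) (Suc n)))"
    by (simp add: sum.Sigma finite_weak_seqs)
  also have "\<dots> = (\<Sum>is\<in>weak_seqs (Suc n) k. f is)"
  proof (rule sum.reindex_bij_witness[where
          j = "\<lambda>(j, is). is @ replicate (k - j) (Suc n)" and
          i = "\<lambda>is. (length (filter (\<lambda>i. i \<noteq> Suc n) is), filter (\<lambda>i. i \<noteq> Suc n) is)"], goal_cases)
    case (1 a)
    then obtain j js where a: "a = (j, js)" "j \<le> k" "js \<in> weak_seqs n j" by auto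
    then have "filter (\<lambda>i. i \<noteq> Suc n) js = js"
      by (intro filter_True) (auto simp: weak_seqs_def)
    then show ?case using a by (simp add: weak_seqs_def)
  next
    case (2 a)
    then show ?case by (auto simp: weak_seqs_def sorted_append set_replicate_conv_if split: if_splits) force+
  next
    case (3 b)
    then show ?case using split[of b k] by (simp add: weak_seqs_def)
  next
    case (4 b)
    then show ?case by (auto simp: weak_seqs_def sorted_filter[of id, simplified] le_Suc_eq dest: subsetD)
  next
    case (5 a)
    then show ?case by auto
  qed
  finally show ?thesis by simp
qed

text \<open>This is W_m(q) in n variables. The coefficients keep the indexed sums of the theorem;
  \<open>weak_gf_nth\<close> passes to \<open>sum_list\<close>, which is additive under
  appending.\<close>

definition weak_gf :: "nat \<Rightarrow> nat \<Rightarrow> rat_mpoly fps" where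
  "weak_gf n m = Abs_fps (\<lambda>k. \<Sum>is\<in>weak_seqs n k. (h n 1 + 2 * (\<Sum>j<k. X (is ! j))) ^ m)"

lemma weak_gf_nth:
  "weak_gf n m $ k = (\<Sum>is\<in>weak_seqs n k. (h n 1 + 2 * sum_list (map X is)) ^ m)"
  unfolding weak_gf_def fps_nth_Abs_fps
  by (rule sum.cong) (auto simp: weak_seqs_def sum_list_sum_nth atLeast0LessThan)

lemma weak_gf_0: "weak_gf 0 m = (if m = 0 then 1 else 0)"
proof (rule fps_ext)
  fix k
  have "weak_seqs 0 k = (if k = 0 then {[]} else {})"
    by (auto simp: weak_seqs_def)
  then show "weak_gf 0 m $ k = (if m = 0 then 1 else 0) $ k"
    by (simp add: weak_gf_nth h_0 power_0_left)
qed

text \<open>A weakly increasing sequence with values up to \<open>n + 1\<close> is determined by its entries up to \<open>n\<close> and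
  the multiplicity of \<open>n + 1\<close>; the powers are then expanded by the binomial theorem.\<close>

lemma weak_gf_Suc:
  "weak_gf (Suc n) m =
   (\<Sum>i\<le>m. fps_const (of_nat (m choose i) * X (Suc n) ^ (m - i)) * (weak_gf n i * odd_power_gf (m - i)))"
proof (rule fps_ext)
  fix k
  define L where "L is = h n 1 + 2 * sum_list (map X is)" for "is"
  \<comment> \<open>The k - j appended copies add 2(k - j) X_(n+1), and \<open>h_Suc_1\<close> adds
    one more: hence the odd factor.\<close>
  have "weak_gf (Suc n) m $ k =
      (\<Sum>j\<le>k. \<Sum>is\<in>weak_seqs n j. (L is + (2 * of_nat (k - j) + 1) * X (Suc n)) ^ m)"
    by (simp add: weak_gf_nth sum_weak_seqs_Suc L_def h_Suc_1[simplified] sum_list_replicate algebra_simps)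
  also have "\<dots> = (\<Sum>j\<le>k. \<Sum>is\<in>weak_seqs n j. \<Sum>i\<le>m.
      of_nat (m choose i) * X (Suc n) ^ (m - i) * (L is ^ i * (2 * of_nat (k - j) + 1) ^ (m - i)))"
    by (simp only: binomial_ring power_mult_distrib mult_ac)
  also have "\<dots> = (\<Sum>j\<le>k. \<Sum>i\<le>m. \<Sum>is\<in>weak_seqs n j.
      of_nat (m choose i) * X (Suc n) ^ (m - i) * (L is ^ i * (2 * of_nat (k - j) + 1) ^ (m - i)))"
    by (intro sum.cong refl sum.swap)
  also have "\<dots> = (\<Sum>i\<le>m. \<Sum>j\<le>k. \<Sum>is\<in>weak_seqs n j.
      of_nat (m choose i) * X (Suc n) ^ (m - i) * (L is ^ i * (2 * of_nat (k - j) + 1) ^ (m - i)))"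
    by (rule sum.swap)
  also have "\<dots> = (\<Sum>i\<le>m. of_nat (m choose i) * X (Suc n) ^ (m - i) *
      (\<Sum>j\<le>k. weak_gf n i $ j * odd_power_gf (m - i) $ (k - j)))"
    by (simp add: weak_gf_nth odd_power_gf_def L_def sum_distrib_left sum_distrib_right)
  finally show "weak_gf (Suc n) m $ k = (\<Sum>i\<le>m. fps_const (of_nat (m choose i) * X (Suc n) ^ (m - i)) *
      (weak_gf n i * odd_power_gf (m - i))) $ k"
    by (simp add: fps_sum_nth fps_mult_nth[of "weak_gf _ _"] atLeast0AtMost)
qed

text \<open>Induction on n: in the i-th term of \<open>weak_gf_Suc\<close> the power (1 - q)^(n+1+m)
  splits as (1 - q)^(n+i) times (1 - q)^(m-i+1), and the degrees i and m - i add up to m. At 1, (m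
  choose i) i! (m - i)! = m! reduces the sum to \<open>h_Suc\<close>.\<close>

lemma palindromic_weak_gf:
  "palindromic ((1 - fps_X) ^ (n + m) * weak_gf n m) m (of_nat (2 ^ m * fact m) * h n m)"
proof (induction n arbitrary: m)
  case 0
  show ?case
    using palindromic_fps_const[of "1 :: rat_mpoly"] palindromic_0[of m]
    by (cases "m = 0") (simp_all add: weak_gf_0 h_0)
next
  case (Suc n)
  let ?c = "\<lambda>i. of_nat (m choose i) * X (Suc n) ^ (m - i)"
  have "palindromic (\<Sum>i\<le>m. fps_const (?c i) *
        (((1 - fps_X) ^ (n + i) * weak_gf n i) * ((1 - fps_X) ^ Suc (m - i) * odd_power_gf (m - i)))) m
      (\<Sum>i\<le>m. ?c i * (of_nat (2 ^ i * fact i) * h n i * of_nat (2 ^ (m - i) * fact (m - i))))"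
  proof (rule palindromic_sum)
    fix i assume "i \<in> {..m}"
    then show "palindromic (fps_const (?c i) *
        (((1 - fps_X) ^ (n + i) * weak_gf n i) * ((1 - fps_X) ^ Suc (m - i) * odd_power_gf (m - i)))) m
      (?c i * (of_nat (2 ^ i * fact i) * h n i * of_nat (2 ^ (m - i) * fact (m - i))))"
      using palindromic_mult[OF palindromic_fps_const palindromic_mult[OF Suc palindromic_odd_power_gf],
          of "?c i" i "m - i"] by simp
  qed
  moreover have "(\<Sum>i\<le>m. fps_const (?c i) *
        (((1 - fps_X) ^ (n + i) * weak_gf n i) * ((1 - fps_X) ^ Suc (m - i) * odd_power_gf (m - i))))
      = (1 - fps_X) ^ (Suc n + m) * weak_gf (Suc n) m"
  proof -
    have "(1 - fps_X :: rat_mpoly fps) ^ (Suc n + m) = (1 - fps_X) ^ (n + i) * (1 - fps_X) ^ Suc (m - i)"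
      if "i \<le> m" for i
      using that by (simp flip: power_add power_Suc)
    then show ?thesis
      unfolding weak_gf_Suc sum_distrib_left
      by (intro sum.cong refl) (simp only: atMost_iff mult_ac)
  qed
  moreover have "(\<Sum>i\<le>m. ?c i * (of_nat (2 ^ i * fact i) * h n i * of_nat (2 ^ (m - i) * fact (m - i))))
      = of_nat (2 ^ m * fact m) * h (Suc n) m"
  proof -
    have "?c i * (of_nat (2 ^ i * fact i) * h n i * of_nat (2 ^ (m - i) * fact (m - i)))
        = of_nat (2 ^ m * fact m) * (h n i * X (Suc n) ^ (m - i))" if "i \<le> m" for i
    proof -
      have "fact m = (m choose i) * fact i * fact (m - i)"
        using binomial_fact_lemma[OF that] by (simp add: mult_ac)
      moreover have "(2 :: nat) ^ m = 2 ^ i * 2 ^ (m - i)"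
        using that by (simp flip: power_add)
      ultimately show ?thesis by (simp only: of_nat_mult mult_ac)
    qed
    then show ?thesis
      unfolding h_Suc sum_distrib_left by (intro sum.cong) auto
  qed
  ultimately show ?case by simp
qed

section \<open>Coefficients, partial sums and half sums\<close>

lemma one_minus_fps_X_power_nth:
  "((1 - fps_X) ^ N :: 'a::comm_ring_1 fps) $ j = (-1) ^ j * of_nat (N choose j)"
proof (induction N arbitrary: j)
  case 0
  show ?case by (cases j) simp_all
next
  case (Suc N)
  then show ?case by (cases j) (simp_all add: left_diff_distrib algebra_simps)
qed

text \<open>Division by 1 - q replaces coefficients by partial sums.\<close>

lemma fps_nth_eq_sum_one_minus_fps_X_mult:
  "F $ d = (\<Sum>i\<le>d. ((1 - fps_X) * F) $ i)" for F :: "'a::comm_ring_1 fps"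
  by (induction d) (simp_all add: left_diff_distrib)

text \<open>Reflection moves the indices below m - d to those above d. For m = 2d + 1 the two sums
  coincide, so twice either one is s; for m = 2d they are the two sums produced by the factor 1 +
  q.\<close>

lemma palindromic_half_sum:
  assumes "palindromic p m s" "d \<le> m"
  shows "(\<Sum>i\<le>d. p $ i) + (\<Sum>i<m - d. p $ i) = s"
proof -
  have sym: "p $ (m - i) = p $ i" if "i \<le> m" for i
    using assms(1) that unfolding palindromic_def by metis
  have "(\<Sum>i<m - d. p $ i) = (\<Sum>i\<in>{Suc d..m}. p $ i)"
    by (rule sum.reindex_bij_witness[where i = "\<lambda>i. m - i" and j = "\<lambda>i. m - i"])
       (auto simp: sym)
  moreover have "{..m} = {..d} \<union> {Suc d..m}" using assms(2) by auto
  then have "(\<Sum>i\<le>m. p $ i) = (\<Sum>i\<le>d. p $ i) + (\<Sum>i\<in>{Suc d..m}. p $ i)"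
    by (simp add: sum.union_disjoint)
  ultimately show ?thesis using assms(1) unfolding palindromic_def by metis
qed

section \<open>Rational constants as polynomials\<close>

lemma Const_mult: "Const a * Const b = Const (a * b)"
  by (simp add: Const_def Poly_Mapping.mult_single)

lemma Const_1: "Const 1 = 1"
  by (simp add: Const_def)

lemma Const_add: "Const (a + b) = Const a + Const b"
  by (simp add: Const_def single_add)

lemma Const_0: "Const 0 = 0"
  by (simp add: Const_def)

lemma Const_of_nat: "Const (of_nat a) = of_nat a"
  by (induction a) (simp_all add: Const_0 Const_1 Const_add)

lemma Const_uminus: "Const (- a) = - Const a"
  by (simp add: Const_def single_uminus)

lemma Const_diff: "Const (a - b) = Const a - Const b"
  by (simp add: Const_def single_diff)

lemma Const_power: "Const (a ^ k) = Const a ^ k"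
  by (induction k) (simp_all add: Const_1 flip: Const_mult)

text \<open>Division by a nonzero integer is multiplication by a constant polynomial, the form of
  the prefactors in the theorem.\<close>

lemma Const_inverse_mult:
  assumes "a \<noteq> 0" "of_nat a * x = y"
  shows "x = Const (1 / of_nat a) * y"
proof -
  have "Const (1 / of_nat a) * y = Const (1 / of_nat a) * Const (of_nat a) * x"
    using assms(2) by (simp add: Const_of_nat mult.assoc)
  then show ?thesis using assms(1) by (simp add: Const_mult Const_1)
qed

theorem theorem3p2:
  fixes n d :: nat
  assumes "n \<ge> 1"
  shows "h n (2 * d + 1) =
           Const (1 / (2 ^ (2 * d) * fact (2 * d + 1))) *
           (\<Sum>k=0..d. Const ((-1) ^ (d - k) * of_nat (binom (n + 2 * d) (int d - int k))) *
              (\<Sum>is\<in>weak_seqs n k. (h n 1 + 2 * (\<Sum>j<k. X (is ! j))) ^ (2 * d + 1))) \<and>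
         h n (2 * d) =
           Const (1 / (2 ^ (2 * d) * fact (2 * d))) *
           (\<Sum>k=0..d. Const ((-1) ^ (d - k) *
                (of_nat (binom (n + 2 * d - 1) (int d - int k)) -
                 of_nat (binom (n + 2 * d - 1) (int d - int k - 1)))) *
              (\<Sum>is\<in>weak_seqs n k. (h n 1 + 2 * (\<Sum>j<k. X (is ! j))) ^ (2 * d)))"
proof
  \<comment> \<open>The exponent is one less than n + m for m = 2d + 1, so \<open>F\<close> is
    P_m(q) / (1 - q).\<close>
  define F where "F = (1 - fps_X) ^ (n + 2 * d) * weak_gf n (2 * d + 1)"
  have P: "palindromic ((1 - fps_X) * F) (2 * d + 1) (of_nat (2 ^ (2 * d + 1) * fact (2 * d + 1)) * h n (2 * d + 1))"
    using palindromic_weak_gf[of n "2 * d + 1"] by (simp add: F_def mult_ac)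
  have "F $ d + F $ d = of_nat (2 ^ (2 * d + 1) * fact (2 * d + 1)) * h n (2 * d + 1)"
    using palindromic_half_sum[OF P, of d] fps_nth_eq_sum_one_minus_fps_X_mult[of F d]
    by (simp add: lessThan_Suc_atMost)
  then have "of_nat 2 * (of_nat (2 ^ (2 * d) * fact (2 * d + 1)) * h n (2 * d + 1)) = 2 * F $ d"
    by (simp add: mult_ac)
  from Const_inverse_mult[OF _ this]
  have "of_nat (2 ^ (2 * d) * fact (2 * d + 1)) * h n (2 * d + 1) = Const (1 / 2) * (Const 2 * F $ d)"
    using Const_of_nat[of 2] by simp
  then have "of_nat (2 ^ (2 * d) * fact (2 * d + 1)) * h n (2 * d + 1) = F $ d"
    by (simp add: Const_mult Const_1 flip: mult.assoc)
  from Const_inverse_mult[OF _ this]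
  have "h n (2 * d + 1) = Const (1 / (2 ^ (2 * d) * fact (2 * d + 1))) * F $ d"
    by (simp del: fact_Suc)
  \<comment> \<open>With \<open>weak_gf\<close> as first factor, the Cauchy product is indexed by
    the sequence length k.\<close>
  moreover have "F $ d = (\<Sum>k=0..d. Const ((-1) ^ (d - k) * of_nat (binom (n + 2 * d) (int d - int k))) *
              (\<Sum>is\<in>weak_seqs n k. (h n 1 + 2 * (\<Sum>j<k. X (is ! j))) ^ (2 * d + 1)))"
    unfolding F_def mult.commute[of "_ ^ _" "weak_gf _ _"] fps_mult_nth
    by (intro sum.cong refl)
       (simp add: one_minus_fps_X_power_nth weak_gf_def binom_def nat_diff_distrib mult.commute Const_of_nat
          Const_power Const_uminus Const_1 flip: Const_mult of_nat_diff)
  ultimately show "h n (2 * d + 1) =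
           Const (1 / (2 ^ (2 * d) * fact (2 * d + 1))) *
           (\<Sum>k=0..d. Const ((-1) ^ (d - k) * of_nat (binom (n + 2 * d) (int d - int k))) *
              (\<Sum>is\<in>weak_seqs n k. (h n 1 + 2 * (\<Sum>j<k. X (is ! j))) ^ (2 * d + 1)))"
    by simp
next
  define N where "N = n + 2 * d - 1"
  define F where "F = (1 - fps_X) ^ N * weak_gf n (2 * d)"
  \<comment> \<open>The assumption n \<ge> 1 keeps the subtraction in \<open>N\<close> from
    truncating.\<close>
  have "Suc N = n + 2 * d" using assms by (simp add: N_def)
  then have "(1 - fps_X) * F = (1 - fps_X) ^ (n + 2 * d) * weak_gf n (2 * d)"
    by (simp add: F_def mult.assoc flip: power_Suc)
  then have P: "palindromic ((1 - fps_X) * F) (2 * d) (of_nat (2 ^ (2 * d) * fact (2 * d)) * h n (2 * d))"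
    using palindromic_weak_gf[of n "2 * d"] by simp
  \<comment> \<open>The factor 1 + q adds the preceding coefficient of \<open>F\<close>, that is the
    partial sum over i < d, empty for d = 0.\<close>
  have "((1 + fps_X) * F) $ d = (\<Sum>i\<le>d. ((1 - fps_X) * F) $ i) + (\<Sum>i<d. ((1 - fps_X) * F) $ i)"
  proof (cases d)
    case (Suc e)
    show ?thesis
      unfolding Suc lessThan_Suc_atMost fps_nth_eq_sum_one_minus_fps_X_mult[of F, symmetric]
      by (simp add: distrib_right)
  qed simp
  then have "of_nat (2 ^ (2 * d) * fact (2 * d)) * h n (2 * d) = ((1 + fps_X) * F) $ d"
    using palindromic_half_sum[OF P, of d] by (simp only: mult_2 diff_add_inverse le_add1)
  from Const_inverse_mult[OF _ this]
  have h_eq: "h n (2 * d) = Const (1 / (2 ^ (2 * d) * fact (2 * d))) * ((1 + fps_X) * F) $ d"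
    by simp
  have nth_eq: "((1 + fps_X) * F) $ d = (\<Sum>k=0..d. Const ((-1) ^ (d - k) *
                (of_nat (binom N (int d - int k)) - of_nat (binom N (int d - int k - 1)))) *
              (\<Sum>is\<in>weak_seqs n k. (h n 1 + 2 * (\<Sum>j<k. X (is ! j))) ^ (2 * d)))"
  proof -
    \<comment> \<open>The copy shifted by q has the opposite sign, whence the difference of
      binomials; for j = 0 the second one is \<open>binom N (-1)\<close>, which is 0.\<close>
    have coeff: "((1 + fps_X) * (1 - fps_X) ^ N) $ j =
        Const ((-1) ^ j * (of_nat (binom N (int j)) - of_nat (binom N (int j - 1))))" for j
      by (cases j) (simp_all add: distrib_right one_minus_fps_X_power_nth binom_def nat_add_distrib Const_of_nat
          Const_power Const_uminus Const_diff Const_1 right_diff_distrib flip: Const_mult)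
    have F_eq: "(1 + fps_X) * F = weak_gf n (2 * d) * ((1 + fps_X) * (1 - fps_X) ^ N)"
      by (simp add: F_def mult_ac)
    show ?thesis
      unfolding F_eq
      by (subst fps_mult_nth) (simp add: coeff weak_gf_def of_nat_diff mult.commute)
  qed
  show "h n (2 * d) =
           Const (1 / (2 ^ (2 * d) * fact (2 * d))) *
           (\<Sum>k=0..d. Const ((-1) ^ (d - k) *
                (of_nat (binom (n + 2 * d - 1) (int d - int k)) -
                 of_nat (binom (n + 2 * d - 1) (int d - int k - 1)))) *
              (\<Sum>is\<in>weak_seqs n k. (h n 1 + 2 * (\<Sum>j<k. X (is ! j))) ^ (2 * d)))"
    using h_eq unfolding nth_eq N_def .
qed

end
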